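(* (i) Let $k\in\{1,2\}$, let $r_1,\dots,r_k$ and $s_1,\dots,s_k$ be positive integers and $s_{k+1}$ a nonnegative integer such that $\sum_{i=1}^t s_i<\sum_{i=1}^t r_i<\sum_{i=1}^{t+1}s_i$ for all $1\leq t<k$, and $n=r_1+\dots+r_k=s_1+\dots+s_{k+1}$. Define $$\alpha_{i,i}=\frac{s_1+\cdots+s_i-r_1-\cdots-r_{i-1}}{r_i s_i},\qquad \alpha_{i,i+1}=\frac{r_1+\cdots+r_i-s_1-\cdots-s_i}{r_i s_{i+1}},$$ assumed positive for each nonvoid block, and let $X^{(\bar r,\bar s)}$ be the $n\times n$ block matrix whose rows are partitioned into consecutive blocks of sizes $r_1,\dots,r_k$ and whose columns are partitioned into consecutive blocks of sizes $s_1,\dots,s_{k+1}$, where the $(i,i)$ block is $\alpha_{i,i}\mathbb{1}_{r_i\times s_i}$, the $(i,i+1)$ block is $\alpha_{i,i+1}\mathbb{1}_{r_i\times s_{i+1}}$ (void if $s_{k+1}=0$ and $i=k$), and all other blocks are zero. Then $X^{(\bar r,\bar s)}$ is an Erdős matrix. In particular, for integers $0<s<r<n$, the matrix $$X^{(r,s,n)}=\begin{pmatrix}\frac1r\mathbb{1}_{r\times s} & \frac{r-s}{r(n-s)}\mathbb{1}_{r\times(n-s)}\\ \mathbf{0}_{(n-r)\times s} & \frac{1}{n-s}\mathbb{1}_{(n-r)\times(n-s)}\end{pmatrix}$$ is an Erdős matrix. (ii) Let $n=2p$, let $\alpha_1,\alpha_2,\alpha_3,\alpha_4\in\{1,\dots,p\}$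 with $\alpha_1+\alpha_4=\alpha_2+\alpha_3$, and let $A_i$ be a $p\times p$ $0/1$ matrix with exactly $\alpha_i$ ones in each row and each column ($i=1,\dots,4$). Then $$X^{\bar\alpha}=\frac{1}{\alpha_1\alpha_4+\alpha_2\alpha_3}\begin{pmatrix}\alpha_4A_1 & \alpha_3A_2\\ \alpha_2A_3 & \alpha_1A_4\end{pmatrix}$$ is an Erdős matrix.
   Context: $\mathbb{1}_{l\times m}$ denotes the $l\times m$ all-ones matrix and $\mathbf{0}$ a zero block. A real $n\times n$ matrix is bistochastic if all entries lie in $[0,1]$ and every row and column sum equals $1$. Let $P_n$ be the set of $n\times n$ permutation matrices; for $\sigma\in P_n$, $\operatorname{tr}_\sigma(M)=\operatorname{tr}(\sigma^TM)$ and $\operatorname{maxtrace}(M)=\max_{\sigma\in P_n}\operatorname{tr}_\sigma(M)$. A bistochastic matrix $E$ is an Erdős matrix if $\operatorname{maxtrace}(E)=\sum_{i,j}E_{i,j}^2$. *)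

theory Defs
  imports Complex_Main "HOL-Combinatorics.Permutations" "Jordan_Normal_Form.Matrix"
begin

definition ones_mat :: "nat \<Rightarrow> nat \<Rightarrow> real mat" where
  "ones_mat l m = mat l m (\<lambda>_. 1)"

definition bistochastic :: "nat \<Rightarrow> real mat \<Rightarrow> bool" where
  "bistochastic n M \<longleftrightarrow>
     M \<in> carrier_mat n n \<and>
     (\<forall>i<n. \<forall>j<n. 0 \<le> M $$ (i,j) \<and> M $$ (i,j) \<le> 1) \<and>
     (\<forall>i<n. (\<Sum>j<n. M $$ (i,j)) = 1) \<and>
     (\<forall>j<n. (\<Sum>i<n. M $$ (i,j)) = 1)"

definition perm_mat :: "nat \<Rightarrow> (nat \<Rightarrow> nat) \<Rightarrow> real mat" where
  "perm_mat n f = mat n n (\<lambda>(i,j). if i = f j then 1 else 0)"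

definition perm_mats :: "nat \<Rightarrow> real mat set" where
  "perm_mats n = {perm_mat n f | f. f permutes {..<n}}"

definition mat_trace :: "real mat \<Rightarrow> real" where
  "mat_trace M = (\<Sum>i<dim_row M. M $$ (i,i))"

definition tr_perm :: "real mat \<Rightarrow> real mat \<Rightarrow> real" where
  "tr_perm P M = mat_trace (transpose_mat P * M)"

definition maxtrace :: "nat \<Rightarrow> real mat \<Rightarrow> real" where
  "maxtrace n M = Max ((\<lambda>P. tr_perm P M) ` perm_mats n)"

definition erdos_mat :: "nat \<Rightarrow> real mat \<Rightarrow> bool" where
  "erdos_mat n E \<longleftrightarrow>
     bistochastic n E \<and> maxtrace n E = (\<Sum>i<n. \<Sum>j<n. (E $$ (i,j))\<^sup>2)"

text \<open>
  Block sizes are families indexed from 1, while matrix indices start at 0: block \<open>a\<close> of the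
  consecutive partition with sizes \<open>d 1, d 2, \<dots>\<close> consists of the indices \<open>i\<close> with
  \<open>d 1 + \<dots> + d (a - 1) \<le> i < d 1 + \<dots> + d a\<close>. Void blocks contain no index.
\<close>

definition block_of :: "(nat \<Rightarrow> nat) \<Rightarrow> nat \<Rightarrow> nat" where
  "block_of d i = (LEAST a. i < (\<Sum>t=1..a. d t))"

lemma block_of_eqI:
  assumes "(\<Sum>t=1..<a. d t) \<le> i" and "i < (\<Sum>t=1..a. d t)"
  shows "block_of d i = a"
  unfolding block_of_def
proof (rule Least_equality)
  show "i < (\<Sum>t=1..a. d t)" by (fact assms)
next
  fix b assume b: "i < (\<Sum>t=1..b. d t)"
  show "a \<le> b"
  proof (rule ccontr)
    assume "\<not> a \<le> b"
    then have "(\<Sum>t=1..b. d t) \<le> (\<Sum>t=1..<a. d t)"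
      by (intro sum_mono2) auto
    with assms(1) b show False by simp
  qed
qed

definition alpha_diag :: "(nat \<Rightarrow> nat) \<Rightarrow> (nat \<Rightarrow> nat) \<Rightarrow> nat \<Rightarrow> real" where
  "alpha_diag r s i =
     (real (\<Sum>t=1..i. s t) - real (\<Sum>t=1..<i. r t)) / (real (r i) * real (s i))"

definition alpha_upper :: "(nat \<Rightarrow> nat) \<Rightarrow> (nat \<Rightarrow> nat) \<Rightarrow> nat \<Rightarrow> real" where
  "alpha_upper r s i =
     (real (\<Sum>t=1..i. r t) - real (\<Sum>t=1..i. s t)) / (real (r i) * real (s (i + 1)))"

definition staircase_mat :: "nat \<Rightarrow> (nat \<Rightarrow> nat) \<Rightarrow> (nat \<Rightarrow> nat) \<Rightarrow> real mat" where
  "staircase_mat n r s = mat n n (\<lambda>(i,j).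
     let a = block_of r i; b = block_of s j in
     if b = a then alpha_diag r s a
     else if b = a + 1 then alpha_upper r s a
     else 0)"

definition rsn_mat :: "nat \<Rightarrow> nat \<Rightarrow> nat \<Rightarrow> real mat" where
  "rsn_mat r s n = four_block_mat
     ((1 / real r) \<cdot>\<^sub>m ones_mat r s)
     (((real r - real s) / (real r * (real n - real s))) \<cdot>\<^sub>m ones_mat r (n - s))
     (0\<^sub>m (n - r) s)
     ((1 / (real n - real s)) \<cdot>\<^sub>m ones_mat (n - r) (n - s))"

definition regular_01_mat :: "nat \<Rightarrow> nat \<Rightarrow> real mat \<Rightarrow> bool" where
  "regular_01_mat p a A \<longleftrightarrow>
     A \<in> carrier_mat p p \<and>
     (\<forall>i<p. \<forall>j<p. A $$ (i,j) \<in> {0, 1}) \<and>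
     (\<forall>i<p. card {j. j < p \<and> A $$ (i,j) = 1} = a) \<and>
     (\<forall>j<p. card {i. i < p \<and> A $$ (i,j) = 1} = a)"

definition alpha_block_mat ::
  "(nat \<Rightarrow> nat) \<Rightarrow> (nat \<Rightarrow> real mat) \<Rightarrow> real mat" where
  "alpha_block_mat \<alpha> A =
     (1 / (real (\<alpha> 1) * real (\<alpha> 4) + real (\<alpha> 2) * real (\<alpha> 3))) \<cdot>\<^sub>m four_block_mat
       (real (\<alpha> 4) \<cdot>\<^sub>m A 1) (real (\<alpha> 3) \<cdot>\<^sub>m A 2)
       (real (\<alpha> 2) \<cdot>\<^sub>m A 3) (real (\<alpha> 1) \<cdot>\<^sub>m A 4)"

end

theory Submission
  imports Defs
begin

text \<open>
  A bistochastic matrix \<open>M\<close> is Erdos as soon as there are potentials \<open>u, v\<close> with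
  \<open>M i j \<le> u i + v j\<close> everywhere and equality on the support of \<open>M\<close>. Indeed every
  \<open>tr\<^sub>\<sigma> M\<close> is at most \<open>\<Sum>u + \<Sum>v\<close>, which equals \<open>\<Sum>M i j (u i + v j) = \<Sum>(M i j)\<^sup>2\<close> by
  bistochasticity, and a permutation inside the support of \<open>M\<close>, which exists by Hall's theorem,
  attains the bound. In all three families the potentials are constant on blocks and found by
  solving the equality constraints.
\<close>

section \<open>Hall's marriage theorem\<close>

text \<open>
  Rado's argument: if some \<open>A i\<close> has two elements, then Hall's condition survives the deletion
  of at least one of them, since two violating families would contradict submodularity of the
  cardinality of the union.
\<close>
lemma hall_marriage:
  fixes A :: "'a \<Rightarrow> 'b set"
  assumes "finite I" and "\<And>i. i \<in> I \<Longrightarrow> finite (A i)"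
    and "\<And>J. J \<subseteq> I \<Longrightarrow> card J \<le> card (\<Union>(A ` J))"
  shows "\<exists>f. inj_on f I \<and> (\<forall>i\<in>I. f i \<in> A i)"
  using assms(2,3)
proof (induction "\<Sum>i\<in>I. card (A i)" arbitrary: A rule: less_induct)
  case less
  note fin = less.prems(1) and hall = less.prems(2)
  show ?case
  proof (cases "\<forall>i\<in>I. \<forall>x\<in>A i. \<forall>y\<in>A i. x = y")
    case True
    have "\<exists>x. A i = {x}" if "i \<in> I" for i
    proof -
      have "card (A i) \<ge> 1" using hall[of "{i}"] that by simp
      then obtain x where "x \<in> A i" by fastforce
      then have "A i = {x}" using True that by blast
      then show ?thesis ..
    qed
    then obtain f where f: "\<And>i. i \<in> I \<Longrightarrow> A i = {f i}" by metis
    have "inj_on f I"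
    proof (rule inj_onI, rule ccontr)
      fix i j assume ij: "i \<in> I" "j \<in> I" "f i = f j" "i \<noteq> j"
      have "card {i, j} \<le> card (\<Union>(A ` {i, j}))" using hall[of "{i,j}"] ij by blast
      with ij f show False by simp
    qed
    with f show ?thesis by blast
  next
    case False
    then obtain i x y where i: "i \<in> I" and xy: "x \<in> A i" "y \<in> A i" "x \<noteq> y" by blast
    \<comment> \<open>If the reduced family satisfies Hall's condition, the induction applies to it.
      Otherwise a violating family must contain \<open>i\<close>, where alone anything changed;
      removing \<open>i\<close> from it weakens the strict inequality to
      \<open>\<le>\<close>.\<close>
    have step: "(\<exists>f. inj_on f I \<and> (\<forall>i\<in>I. f i \<in> A i)) \<or>
        (\<exists>J \<subseteq> I - {i}. card (\<Union>(A ` J) \<union> (A i - {z})) \<le> card J)" if z: "z \<in> A i" for z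
    proof (cases "\<forall>J \<subseteq> I. card J \<le> card (\<Union>((A(i := A i - {z})) ` J))")
      case True
      have "card (A i - {z}) < card (A i)" using fin[OF i] z by (rule card_Diff1_less)
      then have "(\<Sum>j\<in>I. card ((A(i := A i - {z})) j)) < (\<Sum>j\<in>I. card (A j))"
        using i assms(1) by (intro sum_strict_mono_ex1) auto
      then have "\<exists>f. inj_on f I \<and> (\<forall>j\<in>I. f j \<in> (A(i := A i - {z})) j)"
        using True fin by (intro less.hyps) auto
      then obtain f where f: "inj_on f I" "\<forall>j\<in>I. f j \<in> (A(i := A i - {z})) j" by blast
      from f(2) have "\<forall>j\<in>I. f j \<in> A j" by (auto split: if_splits)
      with f(1) show ?thesis by blast
    next
      case False
      then obtain J where J: "J \<subseteq> I" "card (\<Union>((A(i := A i - {z})) ` J)) < card J"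
        by (meson not_le)
      have "i \<in> J"
      proof (rule ccontr)
        assume "i \<notin> J"
        then have "(A(i := A i - {z})) ` J = A ` J" by auto
        with J(2) have "card (\<Union>(A ` J)) < card J" by (simp only:)
        with hall[OF J(1)] show False by simp
      qed
      have eq: "(\<Union>(A ` (J - {i})) \<union> (A i - {z})) = \<Union>((A(i := A i - {z})) ` J)"
        using \<open>i \<in> J\<close> by (auto split: if_splits)
      have "card J = Suc (card (J - {i}))"
        using \<open>i \<in> J\<close> J(1) assms(1) by (metis card.remove finite_subset)
      with J eq have "card (\<Union>(A ` (J - {i})) \<union> (A i - {z})) \<le> card (J - {i})" by simp
      with J(1) show ?thesis by blast
    qed
    show ?thesis
    proof (rule ccontr)
      assume neg: "\<not> ?thesis"
      obtain J where J: "J \<subseteq> I - {i}" "card (\<Union>(A ` J) \<union> (A i - {x})) \<le> card J"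
        using step[OF xy(1)] neg by blast
      obtain K where K: "K \<subseteq> I - {i}" "card (\<Union>(A ` K) \<union> (A i - {y})) \<le> card K"
        using step[OF xy(2)] neg by blast
      let ?U = "\<Union>(A ` J) \<union> (A i - {x})" and ?V = "\<Union>(A ` K) \<union> (A i - {y})"
      have finJK: "finite J" "finite K"
        using J(1) K(1) assms(1) by (auto intro: finite_subset)
      have finUV: "finite ?U" "finite ?V"
        using J(1) K(1) fin finJK i by auto
      \<comment> \<open>As \<open>x\<close> and \<open>y\<close> differ, the two deletions together
        still cover \<open>A i\<close>, so Hall's condition can be used with \<open>i\<close> added
        to \<open>J \<union> K\<close>. This is where the extra 1 comes from.\<close>
      have "card (J \<union> K) + 1 = card (insert i (J \<union> K))"
        using J(1) K(1) finJK by (subst card_insert_disjoint) auto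
      also have "\<dots> \<le> card (\<Union>(A ` insert i (J \<union> K)))"
        using J(1) K(1) i by (intro hall) auto
      also have "\<Union>(A ` insert i (J \<union> K)) = ?U \<union> ?V" using xy by auto
      finally have un: "card (J \<union> K) + 1 \<le> card (?U \<union> ?V)" .
      have "card (J \<inter> K) \<le> card (\<Union>(A ` (J \<inter> K)))"
        using J(1) by (intro hall) auto
      also have "\<dots> \<le> card (?U \<inter> ?V)" using finUV by (intro card_mono) auto
      finally have int: "card (J \<inter> K) \<le> card (?U \<inter> ?V)" .
      \<comment> \<open>Adding the two bounds gives
        \<open>card J + card K + 1 \<le> card ?U + card ?V\<close>, against the choice of
        \<open>J\<close> and \<open>K\<close>.\<close>
      show False
        using un int J(2) K(2) card_Un_Int[OF finJK] card_Un_Int[OF finUV] by linarith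
    qed
  qed
qed

section \<open>Bistochastic matrices and positive diagonals\<close>

text \<open>Each entry is one nonnegative term of a row sum equal to 1, which gives the upper bound
  1.\<close>

lemma bistochasticI:
  assumes "M \<in> carrier_mat n n"
    and nonneg: "\<And>i j. i < n \<Longrightarrow> j < n \<Longrightarrow> 0 \<le> M $$ (i,j)"
    and rows: "\<And>i. i < n \<Longrightarrow> (\<Sum>j<n. M $$ (i,j)) = 1"
    and cols: "\<And>j. j < n \<Longrightarrow> (\<Sum>i<n. M $$ (i,j)) = 1"
  shows "bistochastic n M"
proof -
  have "M $$ (i,j) \<le> 1" if "i < n" "j < n" for i j
    using member_le_sum[of j "{..<n}" "\<lambda>j. M $$ (i,j)"] nonneg rows that by auto
  with assms show ?thesis unfolding bistochastic_def by blast
qed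

text \<open>First step of Birkhoff's theorem: double counting verifies Hall's condition for the
  supports of the columns. A set of columns has total mass equal to its size, all of it lies in the
  rows met by their supports, and each such row has mass 1.\<close>

lemma bistochastic_positive_diagonal:
  assumes M: "bistochastic n M"
  shows "\<exists>f. f permutes {..<n} \<and> (\<forall>j<n. 0 < M $$ (f j, j))"
proof -
  have nonneg: "0 \<le> M $$ (i,j)" if "i < n" "j < n" for i j
    using M that unfolding bistochastic_def by blast
  have rows: "(\<Sum>j<n. M $$ (i,j)) = 1" if "i < n" for i
    using M that unfolding bistochastic_def by blast
  have cols: "(\<Sum>i<n. M $$ (i,j)) = 1" if "j < n" for j
    using M that unfolding bistochastic_def by blast
  define A where "A j = {i. i < n \<and> 0 < M $$ (i,j)}" for j
  have "\<exists>f. inj_on f {..<n} \<and> (\<forall>j\<in>{..<n}. f j \<in> A j)"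
  proof (rule hall_marriage)
    show "finite (A j)" for j unfolding A_def by simp
    fix J assume J: "J \<subseteq> {..<n}"
    let ?N = "\<Union>(A ` J)"
    have N: "?N \<subseteq> {..<n}" unfolding A_def by auto
    have "real (card J) = (\<Sum>j\<in>J. \<Sum>i<n. M $$ (i,j))"
      using J cols by (simp add: subset_iff)
    also have "\<dots> = (\<Sum>j\<in>J. \<Sum>i\<in>?N. M $$ (i,j))"
    proof (rule sum.cong[OF refl], rule sum.mono_neutral_right[OF _ _ ballI])
      fix j i assume ji: "j \<in> J" "i \<in> {..<n} - ?N"
      then have "\<not> 0 < M $$ (i,j)" unfolding A_def by auto
      moreover have "0 \<le> M $$ (i,j)" using ji J by (intro nonneg) auto
      ultimately show "M $$ (i,j) = 0" by simp
    qed (use N in auto)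
    also have "\<dots> = (\<Sum>i\<in>?N. \<Sum>j\<in>J. M $$ (i,j))" by (rule sum.swap)
    also have "\<dots> \<le> (\<Sum>i\<in>?N. \<Sum>j<n. M $$ (i,j))"
      using N J by (intro sum_mono sum_mono2 nonneg) auto
    also have "\<dots> = real (card ?N)"
      using N rows by (simp add: subset_iff)
    finally show "card J \<le> card ?N" by simp
  qed simp
  then obtain f where f: "inj_on f {..<n}" "\<And>j. j < n \<Longrightarrow> f j \<in> A j" by auto
  \<comment> \<open>\<open>permutes\<close> demands the identity outside
    \<open>{..<n}\<close>.\<close>
  define g where "g j = (if j < n then f j else j)" for j
  have "inj_on g {..<n}" using f(1) by (simp add: g_def inj_on_def)
  moreover have "g ` {..<n} \<subseteq> {..<n}" using f(2) by (auto simp: g_def A_def)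
  ultimately have "bij_betw g {..<n} {..<n}"
    by (simp add: bij_betw_def endo_inj_surj)
  then have "g permutes {..<n}" by (rule bij_imp_permutes) (simp add: g_def)
  moreover have "0 < M $$ (g j, j)" if "j < n" for j
    using f(2)[OF that] that by (simp add: g_def A_def)
  ultimately show ?thesis by blast
qed

section \<open>The potential criterion for Erdos matrices\<close>

text \<open>\<open>perm_mat n f\<close> has its ones at the positions \<open>(f j, j)\<close>, so
  the inner product of its column \<open>j\<close> with column \<open>j\<close> of \<open>M\<close>
  selects row \<open>f j\<close>.\<close>

lemma tr_perm_perm_mat:
  assumes f: "f permutes {..<n}" and M: "M \<in> carrier_mat n n"
  shows "tr_perm (perm_mat n f) M = (\<Sum>j<n. M $$ (f j, j))"
proof -
  have "(transpose_mat (perm_mat n f) * M) $$ (j,j) = M $$ (f j, j)" if j: "j < n" for j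
  proof -
    have fj: "f j < n" using permutes_in_image[OF f, of j] j by simp
    have "(transpose_mat (perm_mat n f) * M) $$ (j,j)
        = (\<Sum>i<n. (if i = f j then 1 else 0) * M $$ (i,j))"
      using j M by (auto simp: perm_mat_def scalar_prod_def lessThan_atLeast0 intro!: sum.cong)
    also have "\<dots> = (\<Sum>i<n. if i = f j then M $$ (i,j) else 0)"
      by (intro sum.cong) auto
    also have "\<dots> = M $$ (f j, j)" using fj by simp
    finally show ?thesis .
  qed
  then show ?thesis unfolding tr_perm_def mat_trace_def by (simp add: perm_mat_def)
qed

text \<open>Linear programming duality for the assignment problem: the inequality is dual
  feasibility of \<open>u\<close> and \<open>v\<close>, the equality on the support is complementary
  slackness.\<close>

lemma erdos_mat_if_potentials:
  assumes M: "bistochastic n M"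
    and le: "\<And>i j. i < n \<Longrightarrow> j < n \<Longrightarrow> M $$ (i,j) \<le> u i + v j"
    and eq: "\<And>i j. i < n \<Longrightarrow> j < n \<Longrightarrow> M $$ (i,j) \<noteq> 0 \<Longrightarrow> M $$ (i,j) = u i + v j"
  shows "erdos_mat n M"
proof -
  have carrier: "M \<in> carrier_mat n n" using M unfolding bistochastic_def by blast
  have rows: "(\<Sum>j<n. M $$ (i,j)) = 1" if "i < n" for i
    using M that unfolding bistochastic_def by blast
  have cols: "(\<Sum>i<n. M $$ (i,j)) = 1" if "j < n" for j
    using M that unfolding bistochastic_def by blast
  let ?W = "(\<Sum>i<n. u i) + (\<Sum>j<n. v j)"
  have "(\<Sum>i<n. \<Sum>j<n. (M $$ (i,j))\<^sup>2) = (\<Sum>i<n. \<Sum>j<n. M $$ (i,j) * u i + M $$ (i,j) * v j)"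
  proof (intro sum.cong refl)
    fix i j assume "i \<in> {..<n}" "j \<in> {..<n}"
    then have "M $$ (i,j) = 0 \<or> M $$ (i,j) = u i + v j" using eq[of i j] by auto
    then show "(M $$ (i,j))\<^sup>2 = M $$ (i,j) * u i + M $$ (i,j) * v j"
      by (metis distrib_left mult_zero_left power2_eq_square)
  qed
  also have "\<dots> = (\<Sum>i<n. \<Sum>j<n. M $$ (i,j) * u i) + (\<Sum>j<n. \<Sum>i<n. M $$ (i,j) * v j)"
    by (subst sum.swap[of "\<lambda>j i. M $$ (i,j) * v j"]) (simp add: sum.distrib)
  also have "\<dots> = ?W"
    by (simp add: sum_distrib_right[symmetric] rows cols)
  finally have sq: "(\<Sum>i<n. \<Sum>j<n. (M $$ (i,j))\<^sup>2) = ?W" .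
  \<comment> \<open>A permutation only reorders the row potentials, so all permutations share one
    upper bound.\<close>
  have W: "(\<Sum>j<n. u (f j) + v j) = ?W" if "f permutes {..<n}" for f
    using sum.permute[OF that, of u] by (simp add: sum.distrib comp_def)
  let ?T = "(\<lambda>P. tr_perm P M) ` perm_mats n"
  have "maxtrace n M = ?W" unfolding maxtrace_def
  proof (rule Max_eqI)
    have "perm_mats n = perm_mat n ` {f. f permutes {..<n}}" unfolding perm_mats_def by auto
    then show "finite ?T" by (simp add: finite_permutations)
  next
    fix y assume "y \<in> ?T"
    then obtain f where f: "f permutes {..<n}" and y: "y = tr_perm (perm_mat n f) M"
      unfolding perm_mats_def by auto
    have "y = (\<Sum>j<n. M $$ (f j, j))" using y tr_perm_perm_mat[OF f carrier] by simp
    also have "\<dots> \<le> (\<Sum>j<n. u (f j) + v j)"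
      using permutes_in_image[OF f] by (intro sum_mono le) auto
    finally show "y \<le> ?W" using W[OF f] by simp
  next
    obtain f where f: "f permutes {..<n}" and pos: "\<And>j. j < n \<Longrightarrow> 0 < M $$ (f j, j)"
      using bistochastic_positive_diagonal[OF M] by blast
    have "tr_perm (perm_mat n f) M = (\<Sum>j<n. M $$ (f j, j))"
      by (rule tr_perm_perm_mat[OF f carrier])
    also have "\<dots> = (\<Sum>j<n. u (f j) + v j)"
      using permutes_in_image[OF f] pos by (intro sum.cong refl eq) (auto simp: less_le)
    finally have "tr_perm (perm_mat n f) M = ?W" using W[OF f] by simp
    then show "?W \<in> ?T" unfolding perm_mats_def using f by force
  qed
  with M sq show ?thesis unfolding erdos_mat_def by simp
qed

section \<open>Block-constant matrices\<close>

text \<open>A void block repeats the preceding partial sum, so the least index whose partial sum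
  exceeds \<open>i\<close> never belongs to one; index 0 is excluded because its partial sum is
  empty.\<close>

lemma block_of_bounds:
  assumes "i < (\<Sum>t=1..m. d t)"
  shows "block_of d i \<in> {1..m}" and "0 < d (block_of d i)"
proof -
  let ?b = "block_of d i"
  have upper: "i < (\<Sum>t=1..?b. d t)"
    unfolding block_of_def using assms by (rule LeastI)
  have "?b \<le> m" unfolding block_of_def using assms by (rule Least_le)
  moreover have "?b \<noteq> 0"
  proof
    assume "?b = 0"
    with upper show False by simp
  qed
  ultimately show "?b \<in> {1..m}" by simp
  show "0 < d ?b"
  proof (rule ccontr)
    assume "\<not> 0 < d ?b"
    moreover obtain c where c: "?b = Suc c" using \<open>?b \<noteq> 0\<close> not0_implies_Suc by blast
    ultimately have "i < (\<Sum>t=1..c. d t)" using upper by simp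
    then have "?b \<le> c" unfolding block_of_def by (rule Least_le)
    with c show False by simp
  qed
qed

text \<open>Induction on the number of blocks: the last one adds \<open>d (Suc m)\<close> equal
  terms, none if it is void.\<close>

lemma sum_block_of:
  fixes g :: "nat \<Rightarrow> real"
  shows "(\<Sum>i<(\<Sum>t=1..m. d t). g (block_of d i)) = (\<Sum>a=1..m. real (d a) * g a)"
proof (induction m)
  case (Suc m)
  let ?S = "\<Sum>t=1..m. d t"
  have split: "{..<(\<Sum>t=1..Suc m. d t)} = {..<?S} \<union> {?S..<?S + d (Suc m)}" by auto
  have "block_of d i = Suc m" if "i \<in> {?S..<?S + d (Suc m)}" for i
    using that by (intro block_of_eqI) (auto simp: atLeastLessThanSuc_atLeastAtMost)
  then have "(\<Sum>i\<in>{?S..<?S + d (Suc m)}. g (block_of d i)) = real (d (Suc m)) * g (Suc m)"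
    by simp
  with Suc show ?case unfolding split by (subst sum.union_disjoint) auto
qed simp

text \<open>Reduces the potential criterion to one condition per pair of blocks, with the block
  sizes as weights in the row and column sums. The conditions are restricted to nonvoid blocks
  because the coefficient of a void one may be a quotient by zero, with default value 0.\<close>

lemma erdos_mat_block_constant:
  assumes n: "n = (\<Sum>a=1..k. r a)" "n = (\<Sum>b=1..l. s b)"
    and nonneg: "\<And>a b. a \<in> {1..k} \<Longrightarrow> b \<in> {1..l} \<Longrightarrow> 0 < r a \<Longrightarrow> 0 < s b \<Longrightarrow> 0 \<le> g a b"
    and rows: "\<And>a. a \<in> {1..k} \<Longrightarrow> 0 < r a \<Longrightarrow> (\<Sum>b=1..l. real (s b) * g a b) = 1"
    and cols: "\<And>b. b \<in> {1..l} \<Longrightarrow> 0 < s b \<Longrightarrow> (\<Sum>a=1..k. real (r a) * g a b) = 1"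
    and le: "\<And>a b. a \<in> {1..k} \<Longrightarrow> b \<in> {1..l} \<Longrightarrow> 0 < r a \<Longrightarrow> 0 < s b \<Longrightarrow> g a b \<le> u a + v b"
    and eq: "\<And>a b. a \<in> {1..k} \<Longrightarrow> b \<in> {1..l} \<Longrightarrow> 0 < r a \<Longrightarrow> 0 < s b \<Longrightarrow>
               g a b \<noteq> 0 \<Longrightarrow> g a b = u a + v b"
  shows "erdos_mat n (mat n n (\<lambda>(i,j). g (block_of r i) (block_of s j)))"
    (is "erdos_mat n ?M")
proof -
  have r: "block_of r i \<in> {1..k}" "0 < r (block_of r i)" if "i < n" for i
    using block_of_bounds[of i r k] that n(1) by simp_all
  have s: "block_of s j \<in> {1..l}" "0 < s (block_of s j)" if "j < n" for j
    using block_of_bounds[of j s l] that n(2) by simp_all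
  have "bistochastic n ?M"
  proof (rule bistochasticI)
    fix i assume i: "i < n"
    have "(\<Sum>j<n. ?M $$ (i,j)) = (\<Sum>j<n. g (block_of r i) (block_of s j))" using i by simp
    also have "\<dots> = 1"
      unfolding n(2) using rows[OF r[OF i]] by (subst sum_block_of) simp
    finally show "(\<Sum>j<n. ?M $$ (i,j)) = 1" .
  next
    fix j assume j: "j < n"
    have "(\<Sum>i<n. ?M $$ (i,j)) = (\<Sum>i<n. g (block_of r i) (block_of s j))" using j by simp
    also have "\<dots> = 1"
      unfolding n(1) using cols[OF s[OF j]]
      by (subst sum_block_of[where g = "\<lambda>a. g a (block_of s j)"]) simp
    finally show "(\<Sum>i<n. ?M $$ (i,j)) = 1" .
  qed (use nonneg r s in auto)
  then show ?thesis
    by (rule erdos_mat_if_potentials[where u = "\<lambda>i. u (block_of r i)" and v = "\<lambda>j. v (block_of s j)"])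
      (use le eq r s in auto)
qed

section \<open>Staircase matrices with one or two row blocks\<close>

lemma staircase_mat_eq_block_constant:
  "staircase_mat n r s = mat n n (\<lambda>(i,j).
     (\<lambda>a b. if b = a then alpha_diag r s a else if b = a + 1 then alpha_upper r s a else 0)
       (block_of r i) (block_of s j))"
  by (simp add: staircase_mat_def Let_def)

text \<open>With one block of rows, every nonvoid block has the coefficient
  \<open>1 / real (r 1)\<close>, where \<open>r 1 = n\<close>; the matrix is uniform and constant
  potentials serve.\<close>

lemma erdos_staircase_one:
  assumes r: "0 < r 1" and s: "0 < s 1"
    and n: "n = r 1" "n = s 1 + s 2"
  shows "erdos_mat n (staircase_mat n r s)"
proof -
  have diag: "alpha_diag r s 1 = 1 / real (r 1)"
    using s by (simp add: alpha_diag_def)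
  have set: "{1..2::nat} = {1, 2}" "{1..1::nat} = {1}" by auto
  have R: "real (r 1) = real (s 1) + real (s 2)" using n by simp
  \<comment> \<open>For \<open>s 2 = 0\<close> the quotient takes the default value 0, so the
    formula is claimed only for a nonvoid second block of columns.\<close>
  have upper: "alpha_upper r s 1 = 1 / real (r 1)" if "s 2 \<noteq> 0"
  proof -
    have "alpha_upper r s 1 = real (s 2) / (real (r 1) * real (s 2))"
      unfolding alpha_upper_def set one_add_one using R by simp
    with that show ?thesis by simp
  qed
  have row: "real (s 1) * alpha_diag r s 1 + real (s 2) * alpha_upper r s 1 = 1"
  proof (cases "s 2 = 0")
    case True
    then show ?thesis using diag R r by simp
  next
    case False
    show ?thesis unfolding diag upper[OF False]
      using R r by (simp add: add_divide_distrib[symmetric])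
  qed
  show ?thesis
    unfolding staircase_mat_eq_block_constant
  proof (rule erdos_mat_block_constant[where k = 1 and l = 2 and u = "\<lambda>_. 1 / real (r 1)" and v = "\<lambda>_. 0"],
         unfold set)
    fix a :: nat assume "a \<in> {1}"
    then show "(\<Sum>b\<in>{1,2}. real (s b) * (if b = a then alpha_diag r s a
        else if b = a + 1 then alpha_upper r s a else 0)) = 1"
      using row by simp
  qed (use n r diag upper in auto)
qed

text \<open>The support lies in the staircase of blocks (1,1), (1,2), (2,2), (2,3). Prescribing
  equality along it, with the potential of the first column block set to 0, determines all other
  potentials; it remains to see that the corner blocks (2,1) and (1,3) get nonnegative sums.\<close>

lemma erdos_staircase_two:
  assumes r: "0 < r 1" "0 < r 2" and s: "0 < s 1" "0 < s 2"
    and le: "s 1 \<le> r 1" "r 1 \<le> s 1 + s 2"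
    and n: "n = r 1 + r 2" "n = s 1 + s 2 + s 3"
  shows "erdos_mat n (staircase_mat n r s)"
proof -
  define R1 R2 S1 S2 S3 where RS: "R1 = real (r 1)" "R2 = real (r 2)"
    "S1 = real (s 1)" "S2 = real (s 2)" "S3 = real (s 3)"
  have pos: "0 < R1" "0 < R2" "0 < S1" "0 < S2" "0 \<le> S3" using r s by (simp_all add: RS)
  have rel: "S1 \<le> R1" "R1 \<le> S1 + S2" "R1 + R2 = S1 + S2 + S3"
    unfolding RS using le n by linarith+
  define a11 a12 a22 a23 where a: "a11 = 1 / R1" "a12 = (R1 - S1) / (R1 * S2)"
    "a22 = (S1 + S2 - R1) / (R2 * S2)" "a23 = alpha_upper r s 2"
  have set: "{1..3::nat} = {1, 2, 3}" "{1..2::nat} = {1, 2}" "{1..1::nat} = {1}"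
    "{1..<2::nat} = {1}" by auto
  have alpha: "alpha_diag r s 1 = a11" "alpha_upper r s 1 = a12" "alpha_diag r s 2 = a22"
    using s by (simp_all add: alpha_diag_def alpha_upper_def a RS set
        del: One_nat_def add: One_nat_def[symmetric] one_add_one)
  have alpha': "alpha_diag r s (Suc 0) = a11" "alpha_upper r s (Suc 0) = a12"
    using alpha by simp_all
  \<comment> \<open>A column of the third block meets the support only in the second row block,
    which forces the coefficient \<open>1 / R2\<close>; for \<open>S3 = 0\<close> the definition has
    denominator 0.\<close>
  have a23: "a23 = 1 / R2" if "0 < S3"
  proof -
    have "r 1 + r 2 - (s 1 + s 2) = s 3" "s 1 + s 2 \<le> r 1 + r 2" using n by simp_all
    then have "a23 = S3 / (R2 * S3)"
      using rel unfolding a(4) alpha_upper_def set RS by simp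
    with that show ?thesis by simp
  qed
  \<comment> \<open>True also for \<open>S3 = 0\<close>, so the second row sum needs no case
    distinction.\<close>
  have S3a23: "S3 * a23 = S3 / R2"
    using a23 pos by (cases "S3 = 0") auto
  have nn: "0 \<le> a11" "0 \<le> a12" "0 \<le> a22" "0 < S3 \<Longrightarrow> 0 \<le> a23"
    using pos rel a23 by (auto simp: a)
  \<comment> \<open>\<open>(R1 - S1) / S2\<close> and \<open>(S1 + S2 - R1) / S2\<close> are the
    shares of the two row blocks in the mass of a column of the second block, hence at most
    1.\<close>
  have "a12 = (R1 - S1) / S2 / R1" "a22 = (S1 + S2 - R1) / S2 / R2"
    by (simp_all add: a mult.commute)
  moreover have "(R1 - S1) / S2 \<le> 1" "(S1 + S2 - R1) / S2 \<le> 1" using pos rel by simp_all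
  ultimately have up1: "a12 \<le> a11" and up2: "a22 \<le> 1 / R2"
    using pos unfolding a(1) by (simp_all only: divide_right_mono less_imp_le)
  have row1: "S1 * a11 + S2 * a12 = 1"
    using pos by (simp add: a field_simps)
  have row2: "S2 * a22 + S3 * a23 = 1"
  proof -
    have "S2 * a22 = (S1 + S2 - R1) / R2" using pos by (simp add: a)
    moreover have "S1 + S2 - R1 + S3 = R2" using rel by simp
    ultimately show ?thesis
      using pos unfolding S3a23 by (simp add: add_divide_distrib[symmetric])
  qed
  have col1: "R1 * a11 = 1" using pos by (simp add: a)
  have col2: "R1 * a12 + R2 * a22 = 1"
    using pos by (simp add: a field_simps)
  have col3: "R2 * a23 = 1" if "0 < S3" using a23 pos that by simp
  have S3: "0 < s 3 \<longleftrightarrow> 0 < S3" by (simp add: RS)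
  \<comment> \<open>Solved along the staircase from \<open>?v 1 = 0\<close>. The sum for block (2,1)
    is \<open>a22 - a12 + a11\<close>, nonnegative by \<open>nn\<close> and \<open>up1\<close>; that
    for a nonvoid block (1,3) is \<open>a23 - a22 + a12\<close>, nonnegative by \<open>nn\<close>,
    \<open>a23\<close> and \<open>up2\<close>.\<close>
  let ?u = "\<lambda>a::nat. if a = 1 then a11 else a22 - a12 + a11"
  let ?v = "\<lambda>b::nat. if b = 1 then 0 else if b = 2 then a12 - a11 else a23 - (a22 - a12 + a11)"
  show ?thesis
    unfolding staircase_mat_eq_block_constant
  proof (rule erdos_mat_block_constant[where k = 2 and l = 3 and u = ?u and v = ?v], unfold set)
    fix a :: nat assume "a \<in> {1,2}"
    then show "(\<Sum>b\<in>{1,2,3}. real (s b) * (if b = a then alpha_diag r s a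
        else if b = a + 1 then alpha_upper r s a else 0)) = 1"
      using row1 row2 alpha' alpha(3) a(4)[symmetric] RS[symmetric] by auto
  next
    fix b :: nat assume "b \<in> {1,2,3}" "0 < s b"
    then show "(\<Sum>a\<in>{1,2}. real (r a) * (if b = a then alpha_diag r s a
        else if b = a + 1 then alpha_upper r s a else 0)) = 1"
      using col1 col2 col3 alpha' alpha(3) a(4)[symmetric] RS[symmetric] by auto
  next
    let ?g = "\<lambda>a b. if b = a then alpha_diag r s a else if b = a + 1 then alpha_upper r s a else 0"
    fix a b :: nat assume ab: "a \<in> {1,2}" "b \<in> {1,2,3}" "0 < s b"
    have "0 \<le> ?g a b \<and> ?g a b \<le> ?u a + ?v b \<and> (?g a b \<noteq> 0 \<longrightarrow> ?g a b = ?u a + ?v b)"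
    proof (cases "b = 3")
      case True
      then have "0 < S3" using ab S3 by simp
      with True ab show ?thesis
        using nn a23 up2 a(4) by auto
    next
      case False
      with ab have "b = 1 \<or> b = 2" by blast
      with ab show ?thesis
        using nn(1-3) up1 alpha' alpha(3) by auto
    qed
    then show "0 \<le> ?g a b" "?g a b \<le> ?u a + ?v b" "?g a b \<noteq> 0 \<Longrightarrow> ?g a b = ?u a + ?v b"
      by blast+
  qed (use n in simp_all)
qed

section \<open>The two by two special case\<close>

text \<open>This is the case \<open>k = 2\<close> with a void third column block; the coefficient of
  block (2,2) has numerator \<open>n - r\<close>, which cancels against its row size.\<close>

lemma rsn_mat_eq_staircase_mat:
  assumes "0 < s" "s < r" "r < n"
  shows "rsn_mat r s n = staircase_mat n (\<lambda>i. if i = 1 then r else n - r)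
           (\<lambda>i. if i = 1 then s else if i = 2 then n - s else 0)"
    (is "_ = staircase_mat n ?r ?s")
proof (rule eq_matI)
  have sub: "real (n - s) = real n - real s" "real (n - r) = real n - real r"
    using assms by (simp_all add: of_nat_diff)
  have set: "{1..2::nat} = {1, 2}" "{1..<2::nat} = {1}" by auto
  have diag: "alpha_diag ?r ?s 1 = 1 / real r" "alpha_diag ?r ?s 2 = 1 / (real n - real s)"
    and upper: "alpha_upper ?r ?s 1 = (real r - real s) / (real r * (real n - real s))"
    unfolding alpha_diag_def alpha_upper_def set using assms by (simp_all add: sub)
  have blk_r: "block_of ?r i = (if i < r then 1 else 2)" if "i < n" for i
    unfolding if_split[of "\<lambda>z. _ = z"]
    by (intro conjI impI block_of_eqI) (use that assms set in auto)
  have blk_s: "block_of ?s j = (if j < s then 1 else 2)" if "j < n" for j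
    unfolding if_split[of "\<lambda>z. _ = z"]
    by (intro conjI impI block_of_eqI) (use that assms set in auto)
  fix i j assume "i < dim_row (staircase_mat n ?r ?s)" "j < dim_col (staircase_mat n ?r ?s)"
  then have ij: "i < n" "j < n" by (simp_all add: staircase_mat_def)
  have "i - r < n - r" if "\<not> i < r" using ij(1) that by simp
  moreover have "j - s < n - s" if "\<not> j < s" using ij(2) that by simp
  ultimately show "rsn_mat r s n $$ (i,j) = staircase_mat n ?r ?s $$ (i,j)"
    using ij assms diag upper blk_r[OF ij(1)] blk_s[OF ij(2)]
    by (auto simp: rsn_mat_def staircase_mat_def ones_mat_def Let_def)
qed (use assms in \<open>simp_all add: rsn_mat_def staircase_mat_def ones_mat_def\<close>)

section \<open>Matrices built from regular 0/1 blocks\<close>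

text \<open>A 0/1 entry is the indicator of being 1, so a row or column sum counts ones.\<close>

lemma regular_01_mat_sums:
  assumes A: "regular_01_mat p a A"
  shows "i < p \<Longrightarrow> (\<Sum>j<p. A $$ (i,j)) = real a"
    and "j < p \<Longrightarrow> (\<Sum>i<p. A $$ (i,j)) = real a"
proof -
  have 01: "A $$ (i,j) = (if A $$ (i,j) = 1 then 1 else 0)" if "i < p" "j < p" for i j
    using A that unfolding regular_01_mat_def by auto
  show "(\<Sum>j<p. A $$ (i,j)) = real a" if i: "i < p"
  proof -
    have "(\<Sum>j<p. A $$ (i,j)) = (\<Sum>j<p. if A $$ (i,j) = 1 then 1 else 0)"
      using 01[OF i] by (intro sum.cong) auto
    also have "\<dots> = real (card {j. j < p \<and> A $$ (i,j) = 1})"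
      by (simp add: sum.If_cases Int_def)
    finally show ?thesis using A i unfolding regular_01_mat_def by simp
  qed
  show "(\<Sum>i<p. A $$ (i,j)) = real a" if j: "j < p"
  proof -
    have "(\<Sum>i<p. A $$ (i,j)) = (\<Sum>i<p. if A $$ (i,j) = 1 then 1 else 0)"
      using 01[OF _ j] by (intro sum.cong) auto
    also have "\<dots> = real (card {i. i < p \<and> A $$ (i,j) = 1})"
      by (simp add: sum.If_cases Int_def)
    finally show ?thesis using A j unfolding regular_01_mat_def by simp
  qed
qed

text \<open>Splits a row or column of a matrix of size \<open>2 * p\<close> into halves, the second
  one indexed as in its own block.\<close>

lemma sum_lessThan_double:
  fixes f :: "nat \<Rightarrow> 'a::comm_monoid_add"
  shows "(\<Sum>i<2 * p. f i) = (\<Sum>i<p. f i) + (\<Sum>i<p. f (i + p))"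
  using sum.atLeastLessThan_concat[of 0 p "2 * p" f] sum.shift_bounds_nat_ivl[of f 0 p p]
  by (simp add: lessThan_atLeast0 mult_2)

text \<open>The block coefficients form a 2 by 2 array, and the balance condition says exactly that
  this array is the sum of a row potential and a column potential. Each row or column sum is the
  common denominator divided by itself.\<close>

lemma erdos_alpha_block_mat:
  assumes pos: "\<And>i. i \<in> {1..4} \<Longrightarrow> 0 < \<alpha> i"
    and bal: "\<alpha> 1 + \<alpha> 4 = \<alpha> 2 + \<alpha> 3"
    and A: "\<And>i. i \<in> {1..4} \<Longrightarrow> regular_01_mat p (\<alpha> i) (A i)"
  shows "erdos_mat (2 * p) (alpha_block_mat \<alpha> A)"
proof -
  let ?X = "alpha_block_mat \<alpha> A"
  define D where "D = real (\<alpha> 1) * real (\<alpha> 4) + real (\<alpha> 2) * real (\<alpha> 3)"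
  have "0 < \<alpha> 1" "0 < \<alpha> 2" "0 < \<alpha> 3" "0 < \<alpha> 4" by (auto intro: pos)
  then have D: "D > 0" unfolding D_def by (intro add_pos_pos mult_pos_pos) auto
  have carrier: "A i \<in> carrier_mat p p" if "i \<in> {1..4}" for i
    using A[OF that] unfolding regular_01_mat_def by blast
  have dims: "dim_row (A i) = p" "dim_col (A i) = p" if "i \<in> {1..4}" for i
    using carrier[OF that] by auto
  have entry: "A k $$ (i,j) \<in> {0, 1}" if "k \<in> {1..4}" "i < p" "j < p" for k i j
    using A[OF that(1)] that unfolding regular_01_mat_def by blast
  have entry_nonneg: "0 \<le> A k $$ (i,j)" if "k \<in> {1..4}" "i < p" "j < p" for k i j
    using entry[OF that] by auto
  note sums = regular_01_mat_sums[OF A]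
  define c where "c k = real (\<alpha> k) / D" for k
  have X1: "?X $$ (i,j) = c 4 * A 1 $$ (i,j)" if "i < p" "j < p" for i j
    using that by (simp add: alpha_block_mat_def c_def D_def dims)
  have X2: "?X $$ (i,j + p) = c 3 * A 2 $$ (i,j)" if "i < p" "j < p" for i j
    using that by (simp add: alpha_block_mat_def c_def D_def dims)
  have X3: "?X $$ (i + p,j) = c 2 * A 3 $$ (i,j)" if "i < p" "j < p" for i j
    using that by (simp add: alpha_block_mat_def c_def D_def dims)
  have X4: "?X $$ (i + p,j + p) = c 1 * A 4 $$ (i,j)" if "i < p" "j < p" for i j
    using that by (simp add: alpha_block_mat_def c_def D_def dims)
  have half: "i < p \<or> (\<exists>i'<p. i = i' + p)" if "i < 2 * p" for i
    using that by (cases "i < p") (auto intro!: exI[of _ "i - p"])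
  have one: "c 4 * real (\<alpha> 1) + c 3 * real (\<alpha> 2) = 1"
    "c 2 * real (\<alpha> 3) + c 1 * real (\<alpha> 4) = 1"
    "c 4 * real (\<alpha> 1) + c 2 * real (\<alpha> 3) = 1"
    "c 3 * real (\<alpha> 2) + c 1 * real (\<alpha> 4) = 1"
    using D by (simp_all add: c_def D_def add_divide_distrib[symmetric] mult.commute add.commute)
  have bal': "c 1 = c 2 + c 3 - c 4"
    using arg_cong[OF bal, of real] by (simp add: c_def diff_divide_distrib[symmetric] add_divide_distrib[symmetric])
  have nonneg: "0 \<le> c k" for k using D by (simp add: c_def)
  have bistoch: "bistochastic (2 * p) ?X"
  proof (rule bistochasticI)
    show "?X \<in> carrier_mat (2 * p) (2 * p)"
      by (auto simp: alpha_block_mat_def dims)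
  next
    fix i j assume "i < 2 * p" "j < 2 * p"
    then show "0 \<le> ?X $$ (i,j)"
      using half[of i] half[of j]
      by (auto simp: X1 X2 X3 X4 intro!: mult_nonneg_nonneg nonneg entry_nonneg)
  next
    fix i assume "i < 2 * p"
    then show "(\<Sum>j<2 * p. ?X $$ (i,j)) = 1"
      using half[of i] one
      by (auto simp: sum_lessThan_double X1 X2 X3 X4 sum_distrib_left[symmetric] sums)
  next
    fix j assume "j < 2 * p"
    then show "(\<Sum>i<2 * p. ?X $$ (i,j)) = 1"
      using half[of j] one
      by (auto simp: sum_lessThan_double X1 X2 X3 X4 sum_distrib_left[symmetric] sums)
  qed
  \<comment> \<open>\<open>u\<close> is read off the first column of the array of coefficients and
    \<open>v\<close> off its first row; \<open>bal'\<close> then yields \<open>c 1\<close> in the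
    last block.\<close>
  define u where "u i = (if i < p then c 4 else c 2)" for i
  define v where "v j = (if j < p then 0 else c 3 - c 4)" for j
  \<comment> \<open>On every block the sum of the potentials is the coefficient itself, which is
    nonnegative, so zero entries inside a block satisfy the inequality too.\<close>
  have "0 \<le> u i + v j \<and> ?X $$ (i,j) \<in> {0, u i + v j}" if "i < 2 * p" "j < 2 * p" for i j
  proof -
    have disj: "x * y \<in> {0, x}" if "y \<in> {0, 1}" for x y :: real using that by auto
    have uv: "u i + v j = (if i < p then if j < p then c 4 else c 3
        else if j < p then c 2 else c 1)"
      unfolding u_def v_def using bal' by simp
    show ?thesis unfolding uv
      using half[OF that(1)] half[OF that(2)] disj[OF entry] nonneg
      by (elim disjE exE conjE) (simp_all add: X1 X2 X3 X4)
  qed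
  then show ?thesis
    by (intro erdos_mat_if_potentials[OF bistoch, of u v]) fastforce+
qed

section \<open>The three families together\<close>

theorem theorem1p4:
  shows
    "(\<forall>(k::nat) (r::nat \<Rightarrow> nat) (s::nat \<Rightarrow> nat) (n::nat).
        k \<in> {1, 2} \<longrightarrow>
        (\<forall>i\<in>{1..k}. 0 < r i) \<longrightarrow>
        (\<forall>i\<in>{1..k}. 0 < s i) \<longrightarrow>
        (\<forall>t. 1 \<le> t \<and> t < k \<longrightarrow>
           (\<Sum>i=1..t. s i) < (\<Sum>i=1..t. r i) \<and>
           (\<Sum>i=1..t. r i) < (\<Sum>i=1..t+1. s i)) \<longrightarrow>
        n = (\<Sum>i=1..k. r i) \<longrightarrow>
        n = (\<Sum>i=1..k+1. s i) \<longrightarrow>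
        (\<forall>i\<in>{1..k}. 0 < alpha_diag r s i \<and> (0 < s (i+1) \<longrightarrow> 0 < alpha_upper r s i)) \<longrightarrow>
        erdos_mat n (staircase_mat n r s))
     \<and>
     (\<forall>(r::nat) (s::nat) (n::nat).
        0 < s \<longrightarrow> s < r \<longrightarrow> r < n \<longrightarrow> erdos_mat n (rsn_mat r s n))
     \<and>
     (\<forall>(n::nat) (p::nat) (\<alpha>::nat \<Rightarrow> nat) (A::nat \<Rightarrow> real mat).
        n = 2 * p \<longrightarrow>
        (\<forall>i\<in>{1..4}. \<alpha> i \<in> {1..p}) \<longrightarrow>
        \<alpha> 1 + \<alpha> 4 = \<alpha> 2 + \<alpha> 3 \<longrightarrow>
        (\<forall>i\<in>{1..4}. regular_01_mat p (\<alpha> i) (A i)) \<longrightarrow>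
        erdos_mat n (alpha_block_mat \<alpha> A))"
proof (intro conjI allI impI)
  fix k :: nat and r s :: "nat \<Rightarrow> nat" and n :: nat
  assume k: "k \<in> {1, 2}"
    and r: "\<forall>i\<in>{1..k}. 0 < r i" and s: "\<forall>i\<in>{1..k}. 0 < s i"
    and ord: "\<forall>t. 1 \<le> t \<and> t < k \<longrightarrow>
           (\<Sum>i=1..t. s i) < (\<Sum>i=1..t. r i) \<and>
           (\<Sum>i=1..t. r i) < (\<Sum>i=1..t+1. s i)"
    and n: "n = (\<Sum>i=1..k. r i)" "n = (\<Sum>i=1..k+1. s i)"
  have set: "{1..1 + 1::nat} = {1, 2}" "{1..2::nat} = {1, 2}" "{1..2 + 1::nat} = {1, 2, 3}"
    "{1..1::nat} = {1}" by auto
  from k consider "k = 1" | "k = 2" by blast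
  then show "erdos_mat n (staircase_mat n r s)"
  proof cases
    case 1
    with r s n show ?thesis unfolding 1 set by (intro erdos_staircase_one) simp_all
  next
    case 2
    \<comment> \<open>For \<open>k = 2\<close> the interlacing condition has the single instance
      \<open>t = 1\<close>.\<close>
    have "s 1 < r 1" "r 1 < s 1 + s 2"
      using ord[rule_format, of 1] unfolding 2 set by simp_all
    with r s n show ?thesis unfolding 2 set by (intro erdos_staircase_two) simp_all
  qed
next
  fix r s n :: nat
  assume "0 < s" "s < r" "r < n"
  then show "erdos_mat n (rsn_mat r s n)"
    unfolding rsn_mat_eq_staircase_mat[OF \<open>0 < s\<close> \<open>s < r\<close> \<open>r < n\<close>]
    by (intro erdos_staircase_two) auto
next
  fix n p :: nat and \<alpha> :: "nat \<Rightarrow> nat" and A :: "nat \<Rightarrow> real mat"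
  assume "n = 2 * p" "\<forall>i\<in>{1..4}. \<alpha> i \<in> {1..p}" "\<alpha> 1 + \<alpha> 4 = \<alpha> 2 + \<alpha> 3"
    "\<forall>i\<in>{1..4}. regular_01_mat p (\<alpha> i) (A i)"
  then show "erdos_mat n (alpha_block_mat \<alpha> A)"
    by (auto intro!: erdos_alpha_block_mat simp: Suc_le_eq)
qed

end
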